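(* Suppose that $h:\mathbb{R}^{n\times r}\to\mathbb{R}$ is $\tau$-weakly convex for some $\tau\ge 0$. Then, for any bounded open convex set $\mathcal{U}\subseteq\mathbb{R}^{n\times r}$ that contains $\mathrm{St}(n,r)$, there exists a constant $L>0$ such that $h$ is $L$-Lipschitz continuous on $\mathcal{U}$ (with respect to $\|\cdot\|_F$) and satisfies $$h(Y)\ \ge\ h(X)+\big\langle \widetilde\nabla_{\mathcal R}h(X),\,Y-X\big\rangle-\frac{\tau+L}{2}\|Y-X\|_F^2$$ for all $X,Y\in \mathrm{St}(n,r)$ and all $\widetilde\nabla_{\mathcal R}h(X)\in\partial_{\mathcal R}h(X)$.
   Context: $\mathrm{St}(n,r)=\{X\in\mathbb{R}^{n\times r}: X^\top X=I_r\}$ is the Stiefel manifold, with tangent space $T_X\mathrm{St}=\{\xi\in\mathbb{R}^{n\times r}:\xi^\top X+X^\top\xi=0\}$ at $X$. $\langle A,B\rangle=\mathrm{trace}(A^\top B)$ and $\|A\|_F=\sqrt{\langle A,A\rangle}$. A function $h:\mathbb{R}^{n\times r}\to\mathbb{R}$ is $\tau$-weakly convex ($\tau\ge0$) if $g:=h+\frac{\tau}{2}\|\cdot\|_F^2$ is convex; its Euclidean subdifferential is $\partial h(X)=\partial g(X)-\tau X$, where $\partial g$ is the usual convex subdifferential. The Riemannian subdifferential of $h$ at $X\in\mathrm{St}(n,r)$ is $\partial_{\mathcal R}h(X)=\mathcal{P}_{T_X\mathrm{St}}(\partial h(X))$, where $\mathcal{P}_{T_X\mathrm{St}}(B)=B-\frac12X(B^\top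 X+X^\top B)$ is the orthogonal projector onto $T_X\mathrm{St}$. *)

theory Defs
  imports "HOL-Analysis.Analysis"
begin

definition frob_inner :: "real^'r^'n \<Rightarrow> real^'r^'n \<Rightarrow> real"
  where "frob_inner A B = trace (transpose A ** B)"

definition frob_norm :: "real^'r^'n \<Rightarrow> real"
  where "frob_norm A = sqrt (frob_inner A A)"

text \<open>The norm and the inner product of the type of real matrices are the Frobenius ones, so the
  library notions based on them (open and bounded sets, Lipschitz continuity) refer to the Frobenius
  norm.\<close>

lemma frob_inner_eq_inner: "frob_inner A B = A \<bullet> B"
  unfolding frob_inner_def trace_def transpose_def matrix_matrix_mult_def inner_vec_def
  by (simp, rule sum.swap)

lemma frob_norm_eq_norm: "frob_norm A = norm A"
  by (simp add: frob_norm_def frob_inner_eq_inner norm_eq_sqrt_inner)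

lemma dist_eq_frob_norm: "dist A B = frob_norm (A - B)"
  by (simp add: dist_norm frob_norm_eq_norm)

definition Stiefel :: "(real^'r^'n) set"
  where "Stiefel = {X. transpose X ** X = mat 1}"

definition tangent_space :: "real^'r^'n \<Rightarrow> (real^'r^'n) set"
  where "tangent_space X = {\<xi>. transpose \<xi> ** X + transpose X ** \<xi> = 0}"

definition tangent_proj :: "real^'r^'n \<Rightarrow> real^'r^'n \<Rightarrow> real^'r^'n"
  where "tangent_proj X B = B - (1/2) *\<^sub>R (X ** (transpose B ** X + transpose X ** B))"

lemma transpose_add: "transpose (A + B) = transpose A + transpose (B :: real^'r^'n)"
  by (simp add: transpose_def vec_eq_iff)

lemma transpose_diff: "transpose (A - B) = transpose A - transpose (B :: real^'r^'n)"
  by (simp add: transpose_def vec_eq_iff)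

lemma transpose_scaleR: "transpose (c *\<^sub>R B) = c *\<^sub>R transpose (B :: real^'r^'n)"
  by (simp add: transpose_def vec_eq_iff)

lemma matrix_diff_left: "(A - B) ** C = A ** C - B ** (C :: real^'r^'n)"
  by (simp add: matrix_matrix_mult_def vec_eq_iff left_diff_distrib sum_subtractf)

lemma matrix_diff_right: "A ** (B - C) = A ** B - A ** (C :: real^'r^'n)"
  by (simp add: matrix_matrix_mult_def vec_eq_iff right_diff_distrib sum_subtractf)

lemma matrix_scaleR_left: "(c *\<^sub>R B) ** C = c *\<^sub>R (B ** (C :: real^'r^'n))"
  by (simp add: matrix_matrix_mult_def vec_eq_iff sum_distrib_left mult.assoc)

lemma matrix_scaleR_right: "B ** (c *\<^sub>R C) = c *\<^sub>R (B ** (C :: real^'r^'n))"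
  by (simp add: matrix_matrix_mult_def vec_eq_iff sum_distrib_left mult.left_commute)

lemma tangent_proj_in_tangent_space:
  assumes "X \<in> Stiefel"
  shows "tangent_proj X B \<in> tangent_space X"
proof -
  let ?S = "transpose B ** X + transpose X ** B"
  have S: "transpose ?S = ?S"
    by (simp add: transpose_add matrix_transpose_mul add.commute)
  have X: "transpose X ** X = mat 1"
    using assms by (simp add: Stiefel_def)
  have 1: "transpose (X ** ?S) ** X = ?S"
    by (simp only: matrix_transpose_mul S matrix_mul_assoc[symmetric] X matrix_mul_rid)
  have 2: "transpose X ** (X ** ?S) = ?S"
    by (simp only: matrix_mul_assoc X matrix_mul_lid)
  have "transpose (tangent_proj X B) ** X + transpose X ** tangent_proj X B
      = ?S - (1/2) *\<^sub>R ?S - (1/2) *\<^sub>R ?S"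
    unfolding tangent_proj_def transpose_diff transpose_scaleR matrix_diff_left matrix_diff_right
      matrix_scaleR_left matrix_scaleR_right 1 2
    by (simp add: algebra_simps)
  also have "\<dots> = 0"
    by (simp only: diff_diff_eq scaleR_left_distrib[symmetric]) simp
  finally show ?thesis
    by (simp add: tangent_space_def)
qed

lemma tangent_proj_orthogonal:
  assumes "\<xi> \<in> tangent_space X"
  shows "frob_inner (B - tangent_proj X B) \<xi> = 0"
proof -
  let ?S = "transpose B ** X + transpose X ** B" and ?K = "transpose X ** \<xi>"
  have S: "transpose ?S = ?S"
    by (simp add: transpose_add matrix_transpose_mul add.commute)
  have K: "transpose ?K = - ?K"
    using assms by (simp add: tangent_space_def matrix_transpose_mul add_eq_0_iff2)
  have tr: "trace (transpose A) = trace A" for A :: "real^'r^'r"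
    by (simp add: trace_def transpose_def)
  have "trace (?S ** ?K) = trace (transpose (?S ** ?K))"
    by (simp only: tr)
  also have "\<dots> = trace ((- ?K) ** ?S)"
    by (simp only: matrix_transpose_mul[of ?S ?K] S K)
  also have "\<dots> = - trace (?K ** ?S)"
    by (simp add: trace_def matrix_matrix_mult_def sum_negf)
  also have "\<dots> = - trace (?S ** ?K)"
    by (simp only: trace_mul_sym[of ?K])
  finally have 0: "trace (?S ** ?K) = 0"
    by linarith
  have "frob_inner (B - tangent_proj X B) \<xi> = trace ((1/2) *\<^sub>R (?S ** ?K))"
    by (simp only: frob_inner_def tangent_proj_def diff_diff_eq2 add_diff_cancel_left'
        transpose_scaleR matrix_transpose_mul[of X ?S] S matrix_scaleR_left matrix_mul_assoc)
  also have "\<dots> = (1/2) * trace (?S ** ?K)"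
    unfolding trace_def by (simp add: sum_divide_distrib)
  finally show ?thesis
    using 0 by simp
qed

definition weakly_convex :: "real \<Rightarrow> (real^'r^'n \<Rightarrow> real) \<Rightarrow> bool"
  where "weakly_convex \<tau> h \<longleftrightarrow>
    0 \<le> \<tau> \<and> convex_on UNIV (\<lambda>X. h X + \<tau>/2 * (frob_norm X)\<^sup>2)"

definition convex_subdifferential :: "(real^'r^'n \<Rightarrow> real) \<Rightarrow> real^'r^'n \<Rightarrow> (real^'r^'n) set"
  where "convex_subdifferential g X = {G. \<forall>Y. g Y \<ge> g X + frob_inner G (Y - X)}"

text \<open>The subdifferential of a weakly convex function is defined through that of its convex
  regularisation, hence the explicit modulus argument.\<close>

definition subdifferential ::
    "real \<Rightarrow> (real^'r^'n \<Rightarrow> real) \<Rightarrow> real^'r^'n \<Rightarrow> (real^'r^'n) set"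
  where "subdifferential \<tau> h X =
    (\<lambda>G. G - \<tau> *\<^sub>R X) ` convex_subdifferential (\<lambda>Y. h Y + \<tau>/2 * (frob_norm Y)\<^sup>2) X"

definition riemannian_subdifferential ::
    "real \<Rightarrow> (real^'r^'n \<Rightarrow> real) \<Rightarrow> real^'r^'n \<Rightarrow> (real^'r^'n) set"
  where "riemannian_subdifferential \<tau> h X = tangent_proj X ` subdifferential \<tau> h X"

end

theory Submission
  imports Defs
begin

text \<open>
  Write \<open>h = g - \<tau>/2 \<parallel>\<cdot>\<parallel>\<^sup>2\<close> with \<open>g\<close> convex, let \<open>X, Y\<close> be points of the Stiefel manifold, let
  \<open>D = Y - X\<close>, and let \<open>B\<close> be a Euclidean subgradient of \<open>h\<close> at \<open>X\<close>.  Completing the square in the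
  subgradient inequality of \<open>g\<close> gives
  \<open>h Y \<ge> h X + \<langle>B, D\<rangle> - \<tau>/2 \<parallel>D\<parallel>\<^sup>2\<close>, so what has to be paid for is the replacement of \<open>B\<close> by its
  tangential projection \<open>P B\<close>.

  The chord \<open>D\<close> is tangent to the manifold up to second order: subtracting the two constraints
  \<open>X\<^sup>T X = I\<close> and \<open>Y\<^sup>T Y = I\<close> shows that the symmetric part of \<open>X\<^sup>T D\<close> is \<open>- D\<^sup>T D / 2\<close>.  The normal
  component \<open>B - P B\<close> has the form \<open>X S / 2\<close> with \<open>S\<close> symmetric, hence it only sees that symmetric
  part, and \<open>\<langle>B - P B, D\<rangle> = - \<langle>B, X D\<^sup>T D\<rangle> / 2\<close> (\<open>inner_normal_part_chord\<close>).  As the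
  columns of \<open>X\<close> are orthonormal and the Frobenius norm is submultiplicative, the right-hand side
  is at most \<open>\<parallel>B\<parallel> \<parallel>D\<parallel>\<^sup>2 / 2\<close> in absolute value.

  It remains to bound \<open>\<parallel>B\<parallel>\<close> by a constant.  A finite convex function is Lipschitz on bounded
  sets (\<open>convex_imp_lipschitz_on_bounded\<close>), and so is the squared norm; therefore \<open>h\<close> is
  \<open>L\<close>-Lipschitz on \<open>U\<close> for some \<open>L\<close>.  Since \<open>U\<close> is an open neighbourhood of \<open>X\<close>, a step from \<open>X\<close> in
  the direction \<open>B\<close> shows \<open>\<parallel>B\<parallel> \<le> L\<close> (\<open>norm_proximal_subgradient_le\<close>).
\<close>

section \<open>Convex functions and Lipschitz bounds\<close>

text \<open>
  The function is continuous, hence bounded by some \<open>M\<close> on a closed ball one unit larger than one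
  that contains the set.  Prolonging the segment from \<open>x\<close> to \<open>y\<close> by one unit stays in the larger
  ball.  The original segment is at most a fraction \<open>dist x y\<close> of the prolonged one, and by
  convexity the increment of the function over it is at most the same fraction of \<open>2 M\<close>.
\<close>

lemma convex_imp_lipschitz_on_bounded:
  fixes g :: "'a::euclidean_space \<Rightarrow> real"
  assumes "convex_on UNIV g" and "bounded U"
  obtains L where "L-lipschitz_on U g"
proof -
  obtain R where R: "\<And>x. x \<in> U \<Longrightarrow> norm x \<le> R"
    using \<open>bounded U\<close> by (auto simp: bounded_iff)
  have "continuous_on UNIV g"
    using assms(1) by (intro convex_on_continuous) auto
  then have "compact (g ` cball 0 (R + 1))"
    using continuous_on_subset by (blast intro: compact_continuous_image compact_cball)
  then have "bounded (g ` cball 0 (R + 1))"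
    by (rule compact_imp_bounded)
  then obtain M where M: "\<And>x. x \<in> cball 0 (R + 1) \<Longrightarrow> \<bar>g x\<bar> \<le> M"
    unfolding bounded_iff real_norm_def by blast
  have increment: "g y - g x \<le> 2 * \<bar>M\<bar> * dist x y" if "x \<in> U" "y \<in> U" for x y
  proof (cases "x = y")
    case False
    define d where "d = dist x y"
    define z where "z = x + ((1 + d) / d) *\<^sub>R (y - x)"
    have "d > 0" using False by (simp add: d_def)
    \<comment> \<open>\<open>z\<close> is the point at distance 1 beyond \<open>y\<close>.\<close>
    have "z = y + (1 / d) *\<^sub>R (y - x)"
      using \<open>d > 0\<close> by (simp add: z_def add_divide_distrib algebra_simps)
    moreover have "norm ((1 / d) *\<^sub>R (y - x)) = 1"
      using \<open>d > 0\<close> by (simp add: d_def dist_norm norm_minus_commute)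
    ultimately have "norm z \<le> norm y + 1"
      by (metis norm_triangle_ineq)
    then have "norm z \<le> R + 1"
      using R[OF \<open>y \<in> U\<close>] by simp
    then have gz: "\<bar>g z\<bar> \<le> M" by (intro M) simp
    have gx: "\<bar>g x\<bar> \<le> M" using R[OF \<open>x \<in> U\<close>] by (intro M) simp
    define t where "t = d / (1 + d)"
    have t: "0 \<le> t" "t \<le> 1" "t \<le> d"
      using \<open>d > 0\<close> by (simp_all add: t_def field_simps)
    have "t * ((1 + d) / d) = 1"
      using \<open>d > 0\<close> by (simp add: t_def)
    then have "t *\<^sub>R z = t *\<^sub>R x + (y - x)"
      by (simp only: z_def scaleR_add_right scaleR_scaleR scaleR_one)
    then have "y = (1 - t) *\<^sub>R x + t *\<^sub>R z"
      by (simp add: algebra_simps)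
    then have "g y \<le> (1 - t) * g x + t * g z"
      using convex_onD[OF assms(1), of t x z] t by simp
    then have "g y - g x \<le> t * (g z - g x)"
      by (simp add: algebra_simps)
    also have "\<dots> \<le> t * (2 * \<bar>M\<bar>)"
      using gx gz t by (intro mult_left_mono) auto
    also have "\<dots> \<le> d * (2 * \<bar>M\<bar>)"
      using t by (intro mult_right_mono) auto
    finally show ?thesis by (simp add: d_def mult_ac)
  qed simp
  have "(2 * \<bar>M\<bar>)-lipschitz_on U g"
  proof (rule lipschitz_onI)
    fix x y assume "x \<in> U" "y \<in> U"
    then show "dist (g x) (g y) \<le> 2 * \<bar>M\<bar> * dist x y"
      using increment[of x y] increment[of y x] by (simp add: dist_real_def dist_commute abs_le_iff)
  qed simp
  then show thesis by (rule that)
qed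

lemma lipschitz_on_norm_power2:
  fixes U :: "'a::real_normed_vector set"
  assumes "bounded U"
  obtains L where "L-lipschitz_on U (\<lambda>x. (norm x)\<^sup>2)"
proof -
  obtain R where R: "\<And>x. x \<in> U \<Longrightarrow> norm x \<le> R"
    using assms by (auto simp: bounded_iff)
  have "(2 * \<bar>R\<bar>)-lipschitz_on U (\<lambda>x. (norm x)\<^sup>2)"
  proof (rule lipschitz_onI)
    fix x y assume "x \<in> U" "y \<in> U"
    have "dist ((norm x)\<^sup>2) ((norm y)\<^sup>2) = \<bar>norm x - norm y\<bar> * (norm x + norm y)"
      by (simp add: dist_real_def power2_eq_square square_diff_square_factored abs_mult)
    also have "\<dots> \<le> norm (x - y) * (2 * \<bar>R\<bar>)"
      using R[OF \<open>x \<in> U\<close>] R[OF \<open>y \<in> U\<close>] norm_triangle_ineq3[of x y]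
      by (intro mult_mono) auto
    finally show "dist ((norm x)\<^sup>2) ((norm y)\<^sup>2) \<le> 2 * \<bar>R\<bar> * dist x y"
      by (simp add: dist_norm mult_ac)
  qed simp
  then show thesis by (rule that)
qed

text \<open>
  Along the step \<open>t B\<close> the subgradient inequality forces an increase of \<open>t \<parallel>B\<parallel>\<^sup>2\<close> up to
  \<open>O(t\<^sup>2)\<close>, while the Lipschitz bound allows only \<open>L t \<parallel>B\<parallel>\<close>.
\<close>

lemma norm_proximal_subgradient_le:
  fixes f :: "'a::real_inner \<Rightarrow> real"
  assumes lip: "L-lipschitz_on U f" and "open U" and "x \<in> U"
    and sub: "\<And>y. f y \<ge> f x + B \<bullet> (y - x) - c * (norm (y - x))\<^sup>2"
  shows "norm B \<le> L"
proof (cases "B = 0")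
  case True
  then show ?thesis using lipschitz_on_nonneg[OF lip] by simp
next
  case False
  let ?b = "norm B"
  have "((\<lambda>t. x + t *\<^sub>R B) \<longlongrightarrow> x + 0 *\<^sub>R B) (at_right 0)"
    by (intro tendsto_intros)
  then have "eventually (\<lambda>t. x + t *\<^sub>R B \<in> U) (at_right 0)"
    using topological_tendstoD[OF _ \<open>open U\<close>] \<open>x \<in> U\<close> by simp
  then have "eventually (\<lambda>t. ?b - c * t * ?b \<le> L) (at_right 0)"
    using eventually_at_right_less[of 0]
  proof eventually_elim
    case (elim t)
    have "t * ?b * (?b - c * t * ?b) = B \<bullet> (t *\<^sub>R B) - c * (norm (t *\<^sub>R B))\<^sup>2"
      using elim by (simp add: power2_norm_eq_inner[symmetric] power2_eq_square algebra_simps)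
    also have "\<dots> \<le> f (x + t *\<^sub>R B) - f x"
      using sub[of "x + t *\<^sub>R B"] by simp
    also have "\<dots> \<le> L * (t * ?b)"
      using lipschitz_onD[OF lip elim(1) \<open>x \<in> U\<close>] elim
      by (simp add: dist_real_def dist_norm)
    finally have "t * ?b * (?b - c * t * ?b) \<le> t * ?b * L"
      by (simp add: mult_ac)
    then show ?case
      using elim False by (subst (asm) mult_le_cancel_left_pos) simp_all
  qed
  moreover have "((\<lambda>t. ?b - c * t * ?b) \<longlongrightarrow> ?b - c * 0 * ?b) (at_right 0)"
    by (intro tendsto_intros)
  ultimately show ?thesis
    using tendsto_upperbound[of "\<lambda>t. ?b - c * t * ?b" "?b - c * 0 * ?b" "at_right 0" L] by simp
qed

section \<open>Frobenius geometry of matrices\<close>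

lemma inner_matrix_mult_left:
  fixes A :: "real^'k^'n" and B :: "real^'r^'k"
  shows "(A ** B) \<bullet> C = B \<bullet> (transpose A ** C)"
  by (simp add: frob_inner_eq_inner[symmetric] frob_inner_def matrix_transpose_mul matrix_mul_assoc)

lemma inner_transpose:
  fixes A :: "real^'r^'n"
  shows "transpose A \<bullet> C = A \<bullet> transpose C"
  unfolding inner_vec_def transpose_def by (simp, rule sum.swap)

lemma norm_transpose: "norm (transpose A) = norm (A :: real^'r^'n)"
  by (simp add: norm_eq_sqrt_inner inner_transpose)

lemma norm_matrix_power2: "(norm A)\<^sup>2 = (\<Sum>i\<in>UNIV. (norm (A $ i))\<^sup>2)"
  for A :: "real^'r^'n"
  by (simp add: power2_norm_eq_inner inner_vec_def)

text \<open>
  Each entry of \<open>A ** B\<close> is the inner product of a row of \<open>A\<close> and a column of \<open>B\<close>, to which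
  Cauchy-Schwarz applies.
\<close>

lemma norm_matrix_mult_le:
  fixes A :: "real^'k^'n" and B :: "real^'r^'k"
  shows "norm (A ** B) \<le> norm A * norm B"
proof -
  have entry: "(A ** B) $ i $ j = A $ i \<bullet> transpose B $ j" for i j
    by (simp add: matrix_matrix_mult_def transpose_def inner_vec_def)
  have row: "(norm ((A ** B) $ i))\<^sup>2 = (\<Sum>j\<in>UNIV. (A $ i \<bullet> transpose B $ j)\<^sup>2)" for i
    unfolding power2_norm_eq_inner inner_vec_def[of "(A ** B) $ i"] entry
    by (simp add: power2_eq_square)
  have "(norm (A ** B))\<^sup>2 = (\<Sum>i\<in>UNIV. \<Sum>j\<in>UNIV. (A $ i \<bullet> transpose B $ j)\<^sup>2)"
    by (simp add: norm_matrix_power2 row)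
  also have "\<dots> \<le> (\<Sum>i\<in>UNIV. \<Sum>j\<in>UNIV. (norm (A $ i))\<^sup>2 * (norm (transpose B $ j))\<^sup>2)"
    unfolding power2_norm_eq_inner by (intro sum_mono Cauchy_Schwarz_ineq)
  also have "\<dots> = (norm A)\<^sup>2 * (norm (transpose B))\<^sup>2"
    by (simp only: norm_matrix_power2 sum_product)
  also have "\<dots> = (norm A * norm B)\<^sup>2"
    by (simp add: norm_transpose power_mult_distrib)
  finally show ?thesis
    by (rule power2_le_imp_le) simp
qed

lemma norm_Stiefel_mult:
  assumes "X \<in> Stiefel"
  shows "norm (X ** A) = norm (A :: real^'k^'r)"
  using assms
  by (simp add: norm_eq_sqrt_inner inner_matrix_mult_left matrix_mul_assoc Stiefel_def)

section \<open>Chords of the Stiefel manifold\<close>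

lemma Stiefel_chord_symmetric_part:
  assumes "X \<in> Stiefel" and "Y \<in> Stiefel"
  shows "transpose X ** (Y - X) + transpose (Y - X) ** X = - (transpose (Y - X) ** (Y - X))"
  using assms
  by (simp add: Stiefel_def transpose_diff matrix_diff_left matrix_diff_right)

text \<open>
  The normal component of \<open>B\<close> is \<open>X S / 2\<close> with \<open>S = B\<^sup>T X + X\<^sup>T B\<close>.  Moving \<open>X\<close> to the other side
  pairs the symmetric \<open>S\<close> with \<open>X\<^sup>T (Y - X)\<close>, so only the symmetric part of the latter counts,
  and that part is quadratic in \<open>Y - X\<close>.
\<close>

lemma inner_normal_part_chord:
  assumes "X \<in> Stiefel" and "Y \<in> Stiefel"
  shows "(B - tangent_proj X B) \<bullet> (Y - X)
    = - (1/2) * (B \<bullet> (X ** (transpose (Y - X) ** (Y - X))))"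
proof -
  define D where "D = Y - X"
  define S where "S = transpose B ** X + transpose X ** B"
  have S: "transpose S = S"
    by (simp add: S_def transpose_add matrix_transpose_mul add.commute)
  have DD: "transpose (transpose D ** D) = transpose D ** D"
    by (simp add: matrix_transpose_mul)
  have XD: "transpose (transpose X ** D) = transpose D ** X"
    by (simp add: matrix_transpose_mul)
  have BX: "transpose (transpose X ** B) = transpose B ** X"
    by (simp add: matrix_transpose_mul)
  have "S \<bullet> (transpose D ** X) = S \<bullet> (transpose X ** D)"
    using inner_transpose[of S "transpose X ** D"] by (simp only: S XD)
  then have "2 * (S \<bullet> (transpose X ** D)) = S \<bullet> (transpose X ** D + transpose D ** X)"
    by (simp add: inner_add_right)
  also have "\<dots> = - (S \<bullet> (transpose D ** D))"
    using Stiefel_chord_symmetric_part[OF assms] by (simp add: D_def)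
  also have "S \<bullet> (transpose D ** D) = 2 * ((transpose X ** B) \<bullet> (transpose D ** D))"
    using inner_transpose[of "transpose X ** B" "transpose D ** D"]
    by (simp only: S_def inner_add_left BX DD)
  also have "(transpose X ** B) \<bullet> (transpose D ** D) = B \<bullet> (X ** (transpose D ** D))"
    by (simp add: inner_matrix_mult_left)
  finally have "S \<bullet> (transpose X ** D) = - (B \<bullet> (X ** (transpose D ** D)))"
    by simp
  moreover have "(B - tangent_proj X B) \<bullet> D = (1/2) * (S \<bullet> (transpose X ** D))"
    by (simp add: tangent_proj_def S_def[symmetric] inner_matrix_mult_left)
  ultimately show ?thesis
    by (simp add: D_def)
qed

lemma inner_normal_part_chord_bound:
  assumes "X \<in> Stiefel" and "Y \<in> Stiefel"
  shows "\<bar>(B - tangent_proj X B) \<bullet> (Y - X)\<bar> \<le> norm B / 2 * (norm (Y - X))\<^sup>2"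
proof -
  let ?D = "Y - X"
  have "\<bar>B \<bullet> (X ** (transpose ?D ** ?D))\<bar> \<le> norm B * norm (X ** (transpose ?D ** ?D))"
    by (rule Cauchy_Schwarz_ineq2)
  also have "\<dots> = norm B * norm (transpose ?D ** ?D)"
    by (simp add: norm_Stiefel_mult[OF assms(1)])
  also have "\<dots> \<le> norm B * (norm ?D)\<^sup>2"
    using norm_matrix_mult_le[of "transpose ?D" ?D]
    by (intro mult_left_mono) (simp_all add: norm_transpose power2_eq_square)
  finally show ?thesis
    by (simp add: inner_normal_part_chord[OF assms])
qed

section \<open>Weakly convex functions\<close>

text \<open>
  Expanding \<open>\<parallel>Y\<parallel>\<^sup>2\<close> around \<open>X\<close> turns the subgradient inequality of the convex regularisation into
  this one: the linear terms of the expansion cancel against the shift by \<open>\<tau> X\<close>.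
\<close>

lemma subdifferential_inequality:
  assumes "B \<in> subdifferential \<tau> h X"
  shows "h Y \<ge> h X + B \<bullet> (Y - X) - \<tau>/2 * (norm (Y - X))\<^sup>2"
proof -
  obtain G where B: "B = G - \<tau> *\<^sub>R X"
    and G: "h Y + \<tau>/2 * (norm Y)\<^sup>2 \<ge> h X + \<tau>/2 * (norm X)\<^sup>2 + G \<bullet> (Y - X)"
    using assms
    by (auto simp: subdifferential_def convex_subdifferential_def frob_inner_eq_inner
        frob_norm_eq_norm)
  have "(norm Y)\<^sup>2 = (norm X)\<^sup>2 + 2 * (X \<bullet> (Y - X)) + (norm (Y - X))\<^sup>2"
    by (simp add: power2_norm_eq_inner inner_diff inner_commute)
  then have "\<tau>/2 * (norm Y)\<^sup>2 = \<tau>/2 * (norm X)\<^sup>2 + \<tau> * (X \<bullet> (Y - X)) + \<tau>/2 * (norm (Y - X))\<^sup>2"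
    by (simp add: distrib_left)
  with G show ?thesis
    unfolding B inner_diff_left inner_scaleR_left by linarith
qed

lemma weakly_convex_imp_lipschitz_on_bounded:
  assumes "weakly_convex \<tau> h" and "bounded U"
  obtains L where "L-lipschitz_on U h"
proof -
  have "convex_on UNIV (\<lambda>X. h X + \<tau>/2 * (norm X)\<^sup>2)"
    using assms(1) by (simp add: weakly_convex_def frob_norm_eq_norm)
  then obtain L1 where L1: "L1-lipschitz_on U (\<lambda>X. h X + \<tau>/2 * (norm X)\<^sup>2)"
    using convex_imp_lipschitz_on_bounded \<open>bounded U\<close> by blast
  obtain L2 where "L2-lipschitz_on U (\<lambda>X. (norm X)\<^sup>2)"
    using lipschitz_on_norm_power2 \<open>bounded U\<close> by blast
  then have "(\<bar>\<tau>/2\<bar> * L2)-lipschitz_on U (\<lambda>X. \<tau>/2 * (norm X)\<^sup>2)"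
    by (rule lipschitz_on_cmult_real)
  then have "(L1 + \<bar>\<tau>/2\<bar> * L2)-lipschitz_on U h"
    using lipschitz_on_diff[OF L1] by fastforce
  then show thesis by (rule that)
qed

theorem theorem1:
  fixes h :: "real^'r^'n \<Rightarrow> real" and \<tau> :: real and U :: "(real^'r^'n) set"
  assumes "weakly_convex \<tau> h"
    and "bounded U" and "open U" and "convex U" and "Stiefel \<subseteq> U"
  shows "\<exists>L>0. L-lipschitz_on U h \<and>
    (\<forall>X\<in>Stiefel. \<forall>Y\<in>Stiefel. \<forall>G\<in>riemannian_subdifferential \<tau> h X.
      h Y \<ge> h X + frob_inner G (Y - X) - (\<tau> + L)/2 * (frob_norm (Y - X))\<^sup>2)"
proof -
  obtain L0 where L0: "L0-lipschitz_on U h"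
    by (rule weakly_convex_imp_lipschitz_on_bounded[OF assms(1,2)])
  \<comment> \<open>\<open>L0\<close> may be zero, whereas the constant sought is positive.\<close>
  define L where "L = L0 + 1"
  have "L > 0"
    using lipschitz_on_nonneg[OF L0] by (simp add: L_def)
  have lip: "L-lipschitz_on U h"
    by (rule lipschitz_on_le[OF L0]) (simp add: L_def)
  have "h Y \<ge> h X + frob_inner G (Y - X) - (\<tau> + L)/2 * (frob_norm (Y - X))\<^sup>2"
    if X: "X \<in> Stiefel" and Y: "Y \<in> Stiefel" and "G \<in> riemannian_subdifferential \<tau> h X" for X Y G
  proof -
    obtain B where B: "B \<in> subdifferential \<tau> h X" and G: "G = tangent_proj X B"
      using \<open>G \<in> _\<close> by (auto simp: riemannian_subdifferential_def)
    have "norm B \<le> L"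
      using norm_proximal_subgradient_le[OF lip \<open>open U\<close>, of X B "\<tau>/2"] X \<open>Stiefel \<subseteq> U\<close>
        subdifferential_inequality[OF B] by blast
    then have "norm B / 2 * (norm (Y - X))\<^sup>2 \<le> L / 2 * (norm (Y - X))\<^sup>2"
      by (intro mult_right_mono) auto
    then have "B \<bullet> (Y - X) \<ge> G \<bullet> (Y - X) - L / 2 * (norm (Y - X))\<^sup>2"
      using inner_normal_part_chord_bound[OF X Y, of B]
      unfolding G inner_diff_left by linarith
    then show ?thesis
      using subdifferential_inequality[OF B, of Y]
      by (simp add: frob_inner_eq_inner frob_norm_eq_norm add_divide_distrib distrib_right)
  qed
  with \<open>L > 0\<close> lip show ?thesis by blast
qed

end
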